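(* Let $N\ge 1$, let $z_0,\dots,z_N\in\mathbb R$ be pairwise distinct, $f_0,\dots,f_N\in\mathbb R$ and $z,t\in\mathbb R$. Assume that all $z_j$, $f_j$, $z$, $t$ are exactly representable in the real floating point arithmetic fl, and that $\mathrm{fl}(tz_j)=tz_j$ for $j=0,1,\dots,N$. If the knots are monotonically ordered (i.e. $z_0<z_1<\dots<z_N$ or $z_0>z_1>\dots>z_N$), then the values $\tilde p_n(z;t)=\tilde c_0^{(n)}$, $n=0,1,\dots,N$, computed in fl by Algorithm I (described in the context) satisfy $$\tilde p_{n}(z;t)=\sum_{j=0}^{n}\bigl[f_j(1+\delta_j^{(n)})\bigr]\prod_{i=0,\; i\neq j}^n \frac{z-tz_{i}}{z_{j}-z_{i}}$$ for some numbers $\delta_j^{(n)}$ with $$|\delta_j^{(n)}| \leq 5\,n\,\epsilon_M +\mathcal O(\epsilon_M^{2}).$$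
   Context: Algorithm I. Given pairwise distinct $z_0,\dots,z_N$, values $f_0,\dots,f_N$, and $z,t$, set $c_j^{(0)}:=f_j$ for $j=0,\dots,N$, and for $n=1,\dots,N$ and $k=0,1,\dots,N-n$ compute $$c_k^{(n)}:=\frac{(z-tz_{n+k})\,c_k^{(n-1)}-(z-tz_k)\,c_{k+1}^{(n-1)}}{z_k-z_{k+n}};$$ the output is $p_n(z;t):=c_0^{(n)}$, $n=0,\dots,N$. The operations are carried out as written: the two factors $z-tz_{n+k}$, $z-tz_k$ and the denominator by one subtraction each, then the two multiplications, one subtraction in the numerator, one division. In exact arithmetic $p_n(z;t)=\sum_{j=0}^n f_j\prod_{i=0,\,i\ne j}^n\frac{z-tz_i}{z_j-z_i}$. Floating point model. Quantities with a tilde are those computed in floating point arithmetic. $\epsilon_M>0$ is the machine unit. Exactly representable data enter the computation without rounding error. Every real operation satisfies $\mathrm{fl}(x\odot y)=(x\odot y)(1+\delta)$ with $|\delta|\le\epsilon_M$, for $\odot\in\{+,-,*,/\}$. Convention for $\mathcal O(\epsilon_M^2)$: the bound is understood as $\epsilon_M\to0$ with $N$ and the data $z_j,f_j,z,t$ fixed, i.e. there exist $C,\epsilon_0>0$ depending only on $N$ and the data such that, for every real floating point arithmetic fl with machine unit $\epsilon_M\le\epsilon_0$ in which exactly representable data enter without rounding error and every operation satisfies $\mathrm{fl}(x\odot y)=(x\odot y)(1+\delta)$ with $|\delta|\le\epsilon_M$, for $\odot\in\{+,-,*,/\}$, the term is at most $C\epsilon_M^2$. *)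

theory Defs
  imports Complex_Main
begin

datatype arith_op = Add | Sub | Mul | Div

fun exact_op :: "arith_op \<Rightarrow> real \<Rightarrow> real \<Rightarrow> real" where
  "exact_op Add x y = x + y"
| "exact_op Sub x y = x - y"
| "exact_op Mul x y = x * y"
| "exact_op Div x y = x / y"

(* F is the set of exactly representable numbers; fl op x y stands for fl(x op y).
   Computed results are again machine numbers, so the error model is only demanded for
   operands in F. Taking F = UNIV gives the model in which it holds for all real operands.
   Rounding may depend on the operation and both operands, not just on the exact result.
   Nothing is required of fl Div x 0. *)
definition fp_arithmetic ::
  "real set \<Rightarrow> (arith_op \<Rightarrow> real \<Rightarrow> real \<Rightarrow> real) \<Rightarrow> real \<Rightarrow> bool" where
  "fp_arithmetic F fl \<epsilon> \<longleftrightarrow> \<epsilon> > 0 \<and>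
     (\<forall>op. \<forall>x\<in>F. \<forall>y\<in>F. (op = Div \<longrightarrow> y \<noteq> 0) \<longrightarrow>
        fl op x y \<in> F \<and> (\<exists>\<delta>. \<bar>\<delta>\<bar> \<le> \<epsilon> \<and> fl op x y = exact_op op x y * (1 + \<delta>)))"

(* algorithm_I fl zs f z t n k is the computed c_k^(n). It is a total function of k;
   for n + k <= N only the data with index at most N are used. Input data enter unrounded. *)
fun algorithm_I ::
  "(arith_op \<Rightarrow> real \<Rightarrow> real \<Rightarrow> real) \<Rightarrow> (nat \<Rightarrow> real) \<Rightarrow> (nat \<Rightarrow> real) \<Rightarrow> real \<Rightarrow> real
     \<Rightarrow> nat \<Rightarrow> nat \<Rightarrow> real" where
  "algorithm_I fl zs f z t 0 k = f k"
| "algorithm_I fl zs f z t (Suc n) k =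
     fl Div
       (fl Sub
         (fl Mul (fl Sub z (fl Mul t (zs (Suc n + k)))) (algorithm_I fl zs f z t n k))
         (fl Mul (fl Sub z (fl Mul t (zs k))) (algorithm_I fl zs f z t n (k + 1))))
       (fl Sub (zs k) (zs (k + Suc n)))"

end

theory Submission
  imports Defs
begin

text \<open>
  Exactly computed, every entry of the triangular scheme is a combination of the data \<open>f j\<close> with
  the weights \<^term>\<open>\<Prod>i\<in>I - {j}. (z - t * zs i) / (zs j - zs i)\<close>, where \<open>I\<close> is a block \<open>{k..r}\<close>
  of consecutive indices. One step merges the blocks \<open>{k..r-1}\<close> and \<open>{k+1..r}\<close>, and the weight of
  \<open>f j\<close> on the merged block receives the share \<open>\<lambda> = (zs j - zs r) / (zs k - zs r)\<close> from the first
  block and \<open>1 - \<lambda>\<close> from the second (\<open>weight_extend_right\<close>, \<open>weight_extend_left\<close>). If the knots are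
  monotone, \<open>\<lambda>\<close> lies in \<open>[0, 1]\<close>, so the two shares form a convex combination: no
  cancellation between them can amplify the errors.

  In floating point arithmetic one step attaches to each of the two contributions exactly five
  rounding errors: from the factor \<open>z - t z\<^sub>i\<close>, the multiplication, the subtraction in the numerator,
  the subtraction in the denominator and the division (\<open>algorithm_I_rounded_step\<close>). The relative
  perturbation of \<open>f j\<close> in the new entry is therefore a convex combination of two old
  perturbations, each multiplied by five factors close to \<open>1\<close>. All perturbations after \<open>n\<close> steps
  hence stay in the interval from \<open>(1 - \<epsilon>)\<close> to the power \<open>5 n\<close> up to its reciprocal
  (\<open>algorithm_I_backward_error\<close>). Bernoulli's inequality then gives the linear term
  \<open>5 n \<epsilon>\<close>, up to a quadratic remainder (\<open>error_factor_linear_bound\<close>).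
\<close>

section \<open>Accumulated relative errors\<close>

text \<open>
  The upper end is the reciprocal of the lower end rather than \<open>(1 + \<epsilon>) ^ m\<close>, so that a rounding
  error in a denominator counts exactly like one in a numerator.
\<close>

definition error_factor :: "real \<Rightarrow> nat \<Rightarrow> real \<Rightarrow> bool" where
  "error_factor \<epsilon> m \<theta> \<longleftrightarrow> (1 - \<epsilon>) ^ m \<le> \<theta> \<and> \<theta> \<le> 1 / (1 - \<epsilon>) ^ m"

lemma error_factor_one:
  assumes "0 < \<epsilon>" "\<epsilon> < 1"
  shows "error_factor \<epsilon> m 1"
  using assms by (simp add: error_factor_def power_le_one)

lemma error_factor_rounding:
  assumes "0 < \<epsilon>" "\<epsilon> < 1" "\<bar>\<delta>\<bar> \<le> \<epsilon>"
  shows "error_factor \<epsilon> 1 (1 + \<delta>)"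
proof -
  have "(1 + \<delta>) * (1 - \<epsilon>) \<le> (1 + \<epsilon>) * (1 - \<epsilon>)"
    using assms by (intro mult_right_mono) auto
  also have "\<dots> \<le> 1" by (simp add: algebra_simps)
  finally show ?thesis
    using assms by (auto simp: error_factor_def pos_le_divide_eq)
qed

lemma error_factor_pos:
  assumes "\<epsilon> < 1" "error_factor \<epsilon> m \<theta>"
  shows "0 < \<theta>"
proof -
  have "0 < (1 - \<epsilon>) ^ m" using assms by simp
  then show ?thesis using assms unfolding error_factor_def by linarith
qed

lemma error_factor_mult:
  assumes "\<epsilon> < 1" "error_factor \<epsilon> m \<theta>" "error_factor \<epsilon> l \<eta>"
  shows "error_factor \<epsilon> (m + l) (\<theta> * \<eta>)"
proof -
  note pos = error_factor_pos[OF assms(1,2)] error_factor_pos[OF assms(1,3)]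
  have "(1 - \<epsilon>) ^ m * (1 - \<epsilon>) ^ l \<le> \<theta> * \<eta>"
    using assms pos by (intro mult_mono) (auto simp: error_factor_def)
  moreover have "\<theta> * \<eta> \<le> 1 / (1 - \<epsilon>) ^ m * (1 / (1 - \<epsilon>) ^ l)"
    using assms pos by (intro mult_mono) (auto simp: error_factor_def)
  ultimately show ?thesis by (simp add: error_factor_def power_add)
qed

lemma error_factor_inverse:
  assumes "\<epsilon> < 1" "error_factor \<epsilon> m \<theta>"
  shows "error_factor \<epsilon> m (1 / \<theta>)"
proof -
  have "0 < (1 - \<epsilon>) ^ m" using assms by simp
  then show ?thesis
    using assms(2) error_factor_pos[OF assms]
    by (simp add: error_factor_def field_simps)
qed

lemma error_factor_convex:
  assumes "error_factor \<epsilon> m \<theta>" "error_factor \<epsilon> m \<eta>" "0 \<le> l" "l \<le> 1"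
  shows "error_factor \<epsilon> m (l * \<theta> + (1 - l) * \<eta>)"
proof -
  have "\<theta> \<in> {(1 - \<epsilon>) ^ m..1 / (1 - \<epsilon>) ^ m}" "\<eta> \<in> {(1 - \<epsilon>) ^ m..1 / (1 - \<epsilon>) ^ m}"
    using assms by (auto simp: error_factor_def)
  then have "(1 - \<epsilon>) ^ m \<le> l * \<theta> + (1 - l) * \<eta>" "l * \<theta> + (1 - l) * \<eta> \<le> 1 / (1 - \<epsilon>) ^ m"
    using convex_bound_le[of "- \<theta>" "- ((1 - \<epsilon>) ^ m)" "- \<eta>" l "1 - l"]
      convex_bound_le[of \<theta> "1 / (1 - \<epsilon>) ^ m" \<eta> l "1 - l"] assms
    by auto
  then show ?thesis by (simp add: error_factor_def)
qed

text \<open>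
  By Bernoulli, \<open>x = m \<epsilon>\<close> satisfies \<open>1 - x \<le> (1 - \<epsilon>) ^ m\<close>, and the geometric series
  \<open>1 / (1 - x)\<close> is at most \<open>1 + x + 2 x\<^sup>2\<close> on \<open>[0, 1/2]\<close>.
\<close>

lemma error_factor_linear_bound:
  assumes "0 < \<epsilon>" "\<epsilon> < 1" "real m * \<epsilon> \<le> 1 / 2" "error_factor \<epsilon> m \<theta>"
  shows "\<bar>\<theta> - 1\<bar> \<le> real m * \<epsilon> + 2 * (real m * \<epsilon>)\<^sup>2"
proof -
  define x where "x = real m * \<epsilon>"
  have x: "0 \<le> x" "x \<le> 1 / 2" using assms by (auto simp: x_def)
  have bernoulli: "1 - x \<le> (1 - \<epsilon>) ^ m"
    using Bernoulli_inequality[of "- \<epsilon>" m] assms by (simp add: x_def)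
  have "\<theta> \<le> 1 / (1 - \<epsilon>) ^ m" using assms by (simp add: error_factor_def)
  also have "\<dots> \<le> 1 / (1 - x)"
    using bernoulli x assms by (intro divide_left_mono) auto
  also have "\<dots> \<le> 1 + x + 2 * x\<^sup>2"
  proof -
    have "0 \<le> x\<^sup>2 * (1 - 2 * x)" using x by simp
    then have "1 \<le> (1 + x + 2 * x\<^sup>2) * (1 - x)"
      by (simp add: algebra_simps power2_eq_square)
    then show ?thesis using x by (simp add: pos_divide_le_eq)
  qed
  finally have "\<theta> - 1 \<le> x + 2 * x\<^sup>2" by simp
  moreover have "1 - \<theta> \<le> x + 2 * x\<^sup>2"
    using bernoulli assms(4) zero_le_power2[of x] unfolding error_factor_def by linarith
  ultimately show ?thesis by (simp add: x_def abs_le_iff)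
qed

section \<open>The weights of the data\<close>

definition weight :: "(nat \<Rightarrow> real) \<Rightarrow> real \<Rightarrow> real \<Rightarrow> nat set \<Rightarrow> nat \<Rightarrow> real" where
  "weight zs z t I j = (\<Prod>i\<in>I - {j}. (z - t * zs i) / (zs j - zs i))"

lemma weight_insert:
  assumes "finite I" "i \<notin> I" "j \<in> I"
  shows "weight zs z t (insert i I) j = (z - t * zs i) / (zs j - zs i) * weight zs z t I j"
proof -
  have "insert i I - {j} = insert i (I - {j})" using assms by auto
  then show ?thesis using assms by (simp add: weight_def)
qed

text \<open>
  Adding the knot \<open>r\<close> to the block multiplies the weight of \<open>f j\<close> by \<open>(z - t z\<^sub>r) / (z\<^sub>j - z\<^sub>r)\<close>.
  The algorithm multiplies by \<open>(z - t z\<^sub>r) / (z\<^sub>k - z\<^sub>r)\<close> for all \<open>j\<close> alike, and the quotient of the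
  two is the share of \<open>f j\<close>. The right-hand sum may include the new index \<open>r\<close>, because its share
  is zero.
\<close>

lemma weight_extend_right:
  assumes "k < r" "inj_on zs {k..r}"
  shows "(z - t * zs r) / (zs k - zs r) * (\<Sum>j=k..<r. g j * weight zs z t {k..<r} j)
    = (\<Sum>j=k..r. (zs j - zs r) / (zs k - zs r) * g j * weight zs z t {k..r} j)"
proof -
  have ivl: "{k..r} = insert r {k..<r}" using assms by auto
  have "(z - t * zs r) / (zs k - zs r) * (g j * weight zs z t {k..<r} j)
      = (zs j - zs r) / (zs k - zs r) * g j * weight zs z t {k..r} j"
    if "j \<in> {k..<r}" for j
  proof -
    have "zs j \<noteq> zs r" using that inj_onD[OF assms(2), of j r] by auto
    then show ?thesis unfolding ivl using that by (subst weight_insert) auto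
  qed
  then have "(z - t * zs r) / (zs k - zs r) * (\<Sum>j=k..<r. g j * weight zs z t {k..<r} j)
      = (\<Sum>j=k..<r. (zs j - zs r) / (zs k - zs r) * g j * weight zs z t {k..r} j)"
    unfolding sum_distrib_left by (rule sum.cong[OF refl])
  also have "\<dots> = (\<Sum>j=k..r. (zs j - zs r) / (zs k - zs r) * g j * weight zs z t {k..r} j)"
    by (intro sum.mono_neutral_left) (auto simp: not_less)
  finally show ?thesis .
qed

lemma weight_extend_left:
  assumes "k < r" "inj_on zs {k..r}"
  shows "- (z - t * zs k) / (zs k - zs r) * (\<Sum>j=Suc k..r. g j * weight zs z t {Suc k..r} j)
    = (\<Sum>j=k..r. (1 - (zs j - zs r) / (zs k - zs r)) * g j * weight zs z t {k..r} j)"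
proof -
  have ivl: "{k..r} = insert k {Suc k..r}" using assms by auto
  have kr: "zs k \<noteq> zs r" using inj_onD[OF assms(2), of k r] assms(1) by auto
  have share: "1 - (zs j - zs r) / (zs k - zs r) = - (zs j - zs k) / (zs k - zs r)" for j
    using kr by (simp add: field_simps)
  have "- (z - t * zs k) / (zs k - zs r) * (g j * weight zs z t {Suc k..r} j)
      = (1 - (zs j - zs r) / (zs k - zs r)) * g j * weight zs z t {k..r} j"
    if "j \<in> {Suc k..r}" for j
  proof -
    have "zs j \<noteq> zs k" using that inj_onD[OF assms(2), of j k] by auto
    then show ?thesis unfolding ivl share using that
      by (subst weight_insert) (auto simp: divide_simps, auto simp: algebra_simps)
  qed
  then have "- (z - t * zs k) / (zs k - zs r) * (\<Sum>j=Suc k..r. g j * weight zs z t {Suc k..r} j)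
      = (\<Sum>j=Suc k..r. (1 - (zs j - zs r) / (zs k - zs r)) * g j * weight zs z t {k..r} j)"
    unfolding sum_distrib_left by (rule sum.cong[OF refl])
  also have "\<dots> = (\<Sum>j=k..r. (1 - (zs j - zs r) / (zs k - zs r)) * g j * weight zs z t {k..r} j)"
    using kr by (intro sum.mono_neutral_left) (auto simp: not_less_eq_eq)
  finally show ?thesis .
qed

lemma monotone_share_between_0_1:
  fixes zs :: "nat \<Rightarrow> real"
  assumes "strict_mono_on A zs \<or> strict_antimono_on A zs"
    and "k \<in> A" "j \<in> A" "r \<in> A" "k \<le> j" "j \<le> r" "k < r"
  shows "0 \<le> (zs j - zs r) / (zs k - zs r)" "(zs j - zs r) / (zs k - zs r) \<le> 1"
  using assms(1)
proof (atomize(full), elim disjE)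
  assume "strict_mono_on A zs"
  then have "zs k < zs r" "zs k \<le> zs j" "zs j \<le> zs r"
    using assms(2-) by (auto simp: monotone_on_def order_le_less)
  then show "0 \<le> (zs j - zs r) / (zs k - zs r) \<and> (zs j - zs r) / (zs k - zs r) \<le> 1"
    by (auto simp: divide_simps)
next
  assume "strict_antimono_on A zs"
  then have "zs r < zs k" "zs j \<le> zs k" "zs r \<le> zs j"
    using assms(2-) by (auto simp: monotone_on_def order_le_less)
  then show "0 \<le> (zs j - zs r) / (zs k - zs r) \<and> (zs j - zs r) / (zs k - zs r) \<le> 1"
    by (auto simp: divide_simps)
qed

section \<open>Rounding errors of the scheme\<close>

lemma fp_arithmetic_rounding:
  assumes "fp_arithmetic F fl \<epsilon>" "\<epsilon> < 1" "x \<in> F" "y \<in> F" "op = Div \<Longrightarrow> y \<noteq> 0"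
  obtains \<theta> where "fl op x y = exact_op op x y * \<theta>" "error_factor \<epsilon> 1 \<theta>" "fl op x y \<in> F"
proof -
  obtain \<delta> where "\<bar>\<delta>\<bar> \<le> \<epsilon>" "fl op x y = exact_op op x y * (1 + \<delta>)" "fl op x y \<in> F" "0 < \<epsilon>"
    using assms unfolding fp_arithmetic_def by blast
  then show ?thesis using that error_factor_rounding assms(2) by blast
qed

text \<open>
  The products \<open>t z\<^sub>i\<close> are exact, so each contribution carries two errors of its own, from forming
  and applying the factor \<open>z - t z\<^sub>i\<close>, and shares the three errors of the two remaining subtractions
  and the division with the other contribution.
\<close>

lemma algorithm_I_rounded_step:
  assumes fp: "fp_arithmetic F fl \<epsilon>" and eps: "\<epsilon> < 1"
    and zF: "z \<in> F" and tF: "t \<in> F" and kF: "zs k \<in> F" and rF: "zs (k + Suc n) \<in> F"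
    and exact: "fl Mul t (zs k) = t * zs k" "fl Mul t (zs (k + Suc n)) = t * zs (k + Suc n)"
    and aF: "algorithm_I fl zs f z t n k \<in> F"
    and bF: "algorithm_I fl zs f z t n (Suc k) \<in> F"
    and ne: "zs k \<noteq> zs (k + Suc n)"
  obtains \<theta> \<eta> where
    "algorithm_I fl zs f z t (Suc n) k =
      (z - t * zs (k + Suc n)) / (zs k - zs (k + Suc n)) * (\<theta> * algorithm_I fl zs f z t n k)
      + - (z - t * zs k) / (zs k - zs (k + Suc n)) * (\<eta> * algorithm_I fl zs f z t n (Suc k))"
    "error_factor \<epsilon> 5 \<theta>" "error_factor \<epsilon> 5 \<eta>" "algorithm_I fl zs f z t (Suc n) k \<in> F"
proof -
  define a where "a = algorithm_I fl zs f z t n k"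
  define b where "b = algorithm_I fl zs f z t n (Suc k)"
  define r where "r = k + Suc n"
  note rounding = fp_arithmetic_rounding[OF fp eps]
  have prodF: "t * zs k \<in> F" "t * zs r \<in> F"
    using fp tF kF rF exact unfolding fp_arithmetic_def r_def by (metis arith_op.distinct(11))+
  obtain \<theta>1 where 1: "fl Sub z (t * zs r) = (z - t * zs r) * \<theta>1"
      "error_factor \<epsilon> 1 \<theta>1" "fl Sub z (t * zs r) \<in> F"
    using rounding[OF zF prodF(2), of Sub] by auto
  obtain \<theta>2 where 2: "fl Sub z (t * zs k) = (z - t * zs k) * \<theta>2"
      "error_factor \<epsilon> 1 \<theta>2" "fl Sub z (t * zs k) \<in> F"
    using rounding[OF zF prodF(1), of Sub] by auto
  obtain \<theta>3 where 3: "fl Mul (fl Sub z (t * zs r)) a = fl Sub z (t * zs r) * a * \<theta>3"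
      "error_factor \<epsilon> 1 \<theta>3" "fl Mul (fl Sub z (t * zs r)) a \<in> F"
    using rounding[OF 1(3) aF, of Mul] unfolding a_def by auto
  obtain \<theta>4 where 4: "fl Mul (fl Sub z (t * zs k)) b = fl Sub z (t * zs k) * b * \<theta>4"
      "error_factor \<epsilon> 1 \<theta>4" "fl Mul (fl Sub z (t * zs k)) b \<in> F"
    using rounding[OF 2(3) bF, of Mul] unfolding b_def by auto
  define num where "num = fl Sub (fl Mul (fl Sub z (t * zs r)) a) (fl Mul (fl Sub z (t * zs k)) b)"
  obtain \<theta>5 where 5: "num =
        (fl Mul (fl Sub z (t * zs r)) a - fl Mul (fl Sub z (t * zs k)) b) * \<theta>5"
      "error_factor \<epsilon> 1 \<theta>5" "num \<in> F"
    using rounding[OF 3(3) 4(3), of Sub] unfolding num_def by auto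
  obtain \<theta>6 where 6: "fl Sub (zs k) (zs r) = (zs k - zs r) * \<theta>6"
      "error_factor \<epsilon> 1 \<theta>6" "fl Sub (zs k) (zs r) \<in> F"
    using rounding[OF kF rF, of Sub] unfolding r_def by auto
  have \<theta>6: "\<theta>6 \<noteq> 0" using error_factor_pos[OF eps 6(2)] by simp
  have den: "fl Sub (zs k) (zs r) \<noteq> 0" using 6(1) \<theta>6 ne by (simp add: r_def)
  obtain \<theta>7 where 7: "fl Div num (fl Sub (zs k) (zs r)) = num / fl Sub (zs k) (zs r) * \<theta>7"
      "error_factor \<epsilon> 1 \<theta>7" "fl Div num (fl Sub (zs k) (zs r)) \<in> F"
    using rounding[OF 5(3) 6(3), of Div] den by auto
  have step: "algorithm_I fl zs f z t (Suc n) k = fl Div num (fl Sub (zs k) (zs r))"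
    using exact by (simp add: num_def a_def b_def r_def add.commute)
  have five: "error_factor \<epsilon> 5 (\<theta> * \<eta> * \<theta>5 * (1 / \<theta>6) * \<theta>7)"
    if "error_factor \<epsilon> 1 \<theta>" "error_factor \<epsilon> 1 \<eta>" for \<theta> \<eta>
  proof -
    have "error_factor \<epsilon> (1 + 1 + 1 + 1 + 1) (\<theta> * \<eta> * \<theta>5 * (1 / \<theta>6) * \<theta>7)"
      by (intro error_factor_mult error_factor_inverse eps that 5(2) 6(2) 7(2))
    then show ?thesis by (simp only: numeral_plus_one one_plus_numeral one_add_one semiring_norm)
  qed
  have collect: "(A * \<theta>1 * a * \<theta>3 - B * \<theta>2 * b * \<theta>4) * \<theta>5 / (d * \<theta>6) * \<theta>7
      = A / d * (\<theta>1 * \<theta>3 * \<theta>5 * (1 / \<theta>6) * \<theta>7 * a)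
      + - B / d * (\<theta>2 * \<theta>4 * \<theta>5 * (1 / \<theta>6) * \<theta>7 * b)" for A B d
    by (simp add: divide_inverse algebra_simps)
  show ?thesis
  proof (rule that)
    show "error_factor \<epsilon> 5 (\<theta>1 * \<theta>3 * \<theta>5 * (1 / \<theta>6) * \<theta>7)"
      "error_factor \<epsilon> 5 (\<theta>2 * \<theta>4 * \<theta>5 * (1 / \<theta>6) * \<theta>7)"
      using five 1(2) 2(2) 3(2) 4(2) by auto
    show "algorithm_I fl zs f z t (Suc n) k \<in> F" using step 7(3) by simp
    show "algorithm_I fl zs f z t (Suc n) k =
      (z - t * zs (k + Suc n)) / (zs k - zs (k + Suc n)) *
        (\<theta>1 * \<theta>3 * \<theta>5 * (1 / \<theta>6) * \<theta>7 * algorithm_I fl zs f z t n k)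
      + - (z - t * zs k) / (zs k - zs (k + Suc n)) *
        (\<theta>2 * \<theta>4 * \<theta>5 * (1 / \<theta>6) * \<theta>7 * algorithm_I fl zs f z t n (Suc k))"
      unfolding step 7(1) unfolding 5(1) unfolding 3(1) 4(1) unfolding 1(1) 2(1) 6(1)
      unfolding a_def[symmetric] b_def[symmetric] r_def[symmetric]
      by (rule collect)
  qed
qed

text \<open>
  The factors are claimed for every index, not only for those of the block, so that the induction
  step may combine the factors of the two shorter blocks at each index of the merged one.
\<close>

lemma algorithm_I_backward_error:
  assumes fp: "fp_arithmetic F fl \<epsilon>" and eps: "\<epsilon> < 1"
    and mono: "strict_mono_on {0..N} zs \<or> strict_antimono_on {0..N} zs"
    and inj: "inj_on zs {0..N}"
    and F: "\<And>j. j \<le> N \<Longrightarrow> zs j \<in> F" "\<And>j. j \<le> N \<Longrightarrow> f j \<in> F" "z \<in> F" "t \<in> F"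
    and exact: "\<And>j. j \<le> N \<Longrightarrow> fl Mul t (zs j) = t * zs j"
    and "n + k \<le> N"
  shows "algorithm_I fl zs f z t n k \<in> F \<and>
    (\<exists>\<theta>. (\<forall>j. error_factor \<epsilon> (5 * n) (\<theta> j)) \<and>
      algorithm_I fl zs f z t n k = (\<Sum>j=k..k + n. f j * \<theta> j * weight zs z t {k..k + n} j))"
  using \<open>n + k \<le> N\<close>
proof (induction n arbitrary: k)
  case 0
  have "error_factor \<epsilon> 0 1" by (simp add: error_factor_def)
  then show ?case using 0 F(2)[of k] by (auto simp: weight_def intro!: exI[of _ "\<lambda>_. 1"])
next
  case (Suc n)
  have pos: "0 < \<epsilon>" using fp by (simp add: fp_arithmetic_def)
  define r where "r = k + Suc n"
  have kr: "k < r" "r \<le> N" using Suc.prems by (auto simp: r_def)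
  have inj': "inj_on zs {k..r}" using inj kr by (auto intro: inj_on_subset)
  have ne: "zs k \<noteq> zs r" using inj_onD[OF inj', of k r] kr by auto
  have left: "{k..k + n} = {k..<r}" and right: "{Suc k..Suc k + n} = {Suc k..r}"
    by (auto simp: r_def)
  obtain \<alpha> where \<alpha>: "\<And>j. error_factor \<epsilon> (5 * n) (\<alpha> j)" "algorithm_I fl zs f z t n k \<in> F"
      "algorithm_I fl zs f z t n k = (\<Sum>j=k..<r. f j * \<alpha> j * weight zs z t {k..<r} j)"
    using Suc.IH[of k, unfolded left] Suc.prems by force
  obtain \<beta> where \<beta>: "\<And>j. error_factor \<epsilon> (5 * n) (\<beta> j)" "algorithm_I fl zs f z t n (Suc k) \<in> F"
      "algorithm_I fl zs f z t n (Suc k) = (\<Sum>j=Suc k..r. f j * \<beta> j * weight zs z t {Suc k..r} j)"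
    using Suc.IH[of "Suc k", unfolded right] Suc.prems by force
  have knots: "zs k \<in> F" "zs (k + Suc n) \<in> F"
    and exact_knots: "fl Mul t (zs k) = t * zs k" "fl Mul t (zs (k + Suc n)) = t * zs (k + Suc n)"
    using F(1) exact Suc.prems by simp_all
  obtain \<theta> \<eta> where step: "algorithm_I fl zs f z t (Suc n) k =
      (z - t * zs r) / (zs k - zs r) * (\<theta> * algorithm_I fl zs f z t n k)
      + - (z - t * zs k) / (zs k - zs r) * (\<eta> * algorithm_I fl zs f z t n (Suc k))"
    and errors: "error_factor \<epsilon> 5 \<theta>" "error_factor \<epsilon> 5 \<eta>"
    and inF: "algorithm_I fl zs f z t (Suc n) k \<in> F"
    using algorithm_I_rounded_step[OF fp eps F(3,4) knots exact_knots \<alpha>(2) \<beta>(2) ne[unfolded r_def]]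
    unfolding r_def by blast
  define share where "share j = (zs j - zs r) / (zs k - zs r)" for j
  define \<gamma> where
    "\<gamma> j = (if j \<in> {k..r} then share j * (\<theta> * \<alpha> j) + (1 - share j) * (\<eta> * \<beta> j) else 1)" for j
  have "error_factor \<epsilon> (5 * Suc n) (\<gamma> j)" for j
  proof (cases "j \<in> {k..r}")
    case True
    have "error_factor \<epsilon> (5 * Suc n) (\<theta> * \<alpha> j)" "error_factor \<epsilon> (5 * Suc n) (\<eta> * \<beta> j)"
      using error_factor_mult[OF eps errors(1) \<alpha>(1)] error_factor_mult[OF eps errors(2) \<beta>(1)]
      by simp_all
    moreover have "0 \<le> share j" "share j \<le> 1"
      using monotone_share_between_0_1[OF mono, of k j r] True kr unfolding share_def by auto
    ultimately show ?thesis unfolding \<gamma>_def using True by (simp add: error_factor_convex)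
  next
    case False
    then have "\<gamma> j = 1" by (simp only: \<gamma>_def if_False)
    then show ?thesis using error_factor_one[OF pos eps] by simp
  qed
  moreover have "algorithm_I fl zs f z t (Suc n) k = (\<Sum>j=k..r. f j * \<gamma> j * weight zs z t {k..r} j)"
  proof -
    have "\<theta> * algorithm_I fl zs f z t n k
        = (\<Sum>j=k..<r. (\<theta> * (f j * \<alpha> j)) * weight zs z t {k..<r} j)"
      "\<eta> * algorithm_I fl zs f z t n (Suc k)
        = (\<Sum>j=Suc k..r. (\<eta> * (f j * \<beta> j)) * weight zs z t {Suc k..r} j)"
      unfolding \<alpha>(3) \<beta>(3) sum_distrib_left by (simp_all only: mult.assoc)
    then have "algorithm_I fl zs f z t (Suc n) k =
        (\<Sum>j=k..r. share j * (\<theta> * (f j * \<alpha> j)) * weight zs z t {k..r} j)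
        + (\<Sum>j=k..r. (1 - share j) * (\<eta> * (f j * \<beta> j)) * weight zs z t {k..r} j)"
      unfolding step
      by (simp only: weight_extend_right[OF kr(1) inj'] weight_extend_left[OF kr(1) inj'] share_def)
    also have "\<dots> = (\<Sum>j=k..r. f j * \<gamma> j * weight zs z t {k..r} j)"
      unfolding sum.distrib[symmetric]
      by (intro sum.cong refl) (auto simp: \<gamma>_def algebra_simps)
    finally show ?thesis .
  qed
  ultimately show ?case using inF unfolding r_def by blast
qed

theorem proposition1:
  fixes N :: nat and zs f :: "nat \<Rightarrow> real" and z t :: real
  assumes "N \<ge> 1"
    and "inj_on zs {0..N}"
    and "strict_mono_on {0..N} zs \<or> strict_antimono_on {0..N} zs"
  shows "\<exists>C>0. \<exists>\<epsilon>\<^sub>0>0. \<forall>F fl \<epsilon>.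
    fp_arithmetic F fl \<epsilon> \<and> \<epsilon> \<le> \<epsilon>\<^sub>0 \<and>
    (\<forall>j\<le>N. zs j \<in> F \<and> f j \<in> F) \<and> z \<in> F \<and> t \<in> F \<and>
    (\<forall>j\<le>N. fl Mul t (zs j) = t * zs j) \<longrightarrow>
    (\<forall>n\<le>N. \<exists>\<delta> :: nat \<Rightarrow> real.
       algorithm_I fl zs f z t n 0 =
         (\<Sum>j=0..n. (f j * (1 + \<delta> j)) * (\<Prod>i\<in>{0..n} - {j}. (z - t * zs i) / (zs j - zs i))) \<and>
       (\<forall>j\<le>n. \<bar>\<delta> j\<bar> \<le> 5 * real n * \<epsilon> + C * \<epsilon>\<^sup>2))"
proof -
  \<comment> \<open>This threshold makes \<open>5 n \<epsilon> \<le> 1/2\<close> for all \<open>n \<le> N\<close>; then \<open>2 (5 n \<epsilon>)\<^sup>2 \<le> 50 N\<^sup>2 \<epsilon>\<^sup>2\<close>.\<close>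
  define C where "C = 50 * (real N)\<^sup>2"
  define \<epsilon>0 where "\<epsilon>0 = 1 / (10 * real N)"
  have N: "real N \<ge> 1" using assms(1) by simp
  have "\<exists>\<delta> :: nat \<Rightarrow> real.
       algorithm_I fl zs f z t n 0 =
         (\<Sum>j=0..n. (f j * (1 + \<delta> j)) * (\<Prod>i\<in>{0..n} - {j}. (z - t * zs i) / (zs j - zs i))) \<and>
       (\<forall>j\<le>n. \<bar>\<delta> j\<bar> \<le> 5 * real n * \<epsilon> + C * \<epsilon>\<^sup>2)"
    if fp: "fp_arithmetic F fl \<epsilon>" and small: "\<epsilon> \<le> \<epsilon>0"
      and F: "\<forall>j\<le>N. zs j \<in> F \<and> f j \<in> F" "z \<in> F" "t \<in> F"
      and exact: "\<forall>j\<le>N. fl Mul t (zs j) = t * zs j" and n: "n \<le> N"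
    for F fl \<epsilon> n
  proof -
    have pos: "0 < \<epsilon>" using fp by (simp add: fp_arithmetic_def)
    have "real N * \<epsilon> \<le> real N * \<epsilon>0" using small by (intro mult_left_mono) auto
    also have "\<dots> = 1 / 10" using N by (simp add: \<epsilon>0_def)
    finally have Ne: "real N * \<epsilon> \<le> 1 / 10" .
    have eps: "\<epsilon> < 1" using mult_right_mono[OF N, of \<epsilon>] Ne pos by linarith
    have ne: "real n * \<epsilon> \<le> real N * \<epsilon>" using n pos by (intro mult_right_mono) auto
    obtain \<theta> where \<theta>: "\<And>j. error_factor \<epsilon> (5 * n) (\<theta> j)"
      "algorithm_I fl zs f z t n 0 = (\<Sum>j=0..n. f j * \<theta> j * weight zs z t {0..n} j)"
      using algorithm_I_backward_error[OF fp eps assms(3,2), of f z t n 0] F exact n by auto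
    have bound: "\<bar>\<theta> j - 1\<bar> \<le> 5 * real n * \<epsilon> + C * \<epsilon>\<^sup>2" for j
    proof -
      have "(real n * \<epsilon>)\<^sup>2 \<le> (real N * \<epsilon>)\<^sup>2" using ne pos by (intro power_mono) auto
      then have "2 * (real (5 * n) * \<epsilon>)\<^sup>2 \<le> C * \<epsilon>\<^sup>2"
        by (simp add: C_def power_mult_distrib)
      moreover have "real (5 * n) * \<epsilon> \<le> 1 / 2" using ne Ne by simp
      ultimately show ?thesis
        using error_factor_linear_bound[OF pos eps _ \<theta>(1), of j] by simp
    qed
    show ?thesis
      using \<theta>(2) bound by (intro exI[of _ "\<lambda>j. \<theta> j - 1"]) (simp add: weight_def)
  qed
  moreover have "C > 0" "\<epsilon>0 > 0" using N by (auto simp: C_def \<epsilon>0_def)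
  ultimately show ?thesis by blast
qed

end
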